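(* Let $G$ be a graph containing a geodesic cycle of length $k$. Then $\mathrm{tw}(G)\ge k/\ell(G)$.
   Context: Graphs are finite, simple and undirected. $\mathrm{tw}(G)$ is the usual tree-width of $G$ (minimum over all tree-decompositions of the maximum part size minus one). A cycle $C$ in $G$ is geodesic if for any two of its vertices it contains a shortest path of $G$ between them. $\ell(G)$ denotes the smallest natural number $\ell$ such that the cycles of $G$ of length at most $\ell$ generate the cycle space of $G$ (over $\mathbb{F}_2$). *)

theory Defs
  imports Complex_Main "HOL-Library.Z2" "HOL-Library.Function_Algebras" "HOL-Library.Indicator_Function"
begin

record 'a ugraph =
  verts :: "'a set"
  edges :: "'a set set"

definition simple_graph :: "'a ugraph \<Rightarrow> bool" where
  "simple_graph G \<longleftrightarrow>
     finite (verts G) \<and> (\<forall>e\<in>edges G. e \<subseteq> verts G \<and> card e = 2)"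

(* Paths and cycles are given by vertex sequences: the path x0 ... xn is [x0,...,xn], and the
   cycle x1 ... xk x1 is [x1,...,xk], without repeating x1; so "length" of the list of a cycle is
   the length of the cycle, while a path with list p has length p - 1 edges. *)

fun path_edges :: "'a list \<Rightarrow> 'a set set" where
  "path_edges (x # y # xs) = insert {x, y} (path_edges (y # xs))"
| "path_edges _ = {}"

definition cycle_edges :: "'a list \<Rightarrow> 'a set set" where
  "cycle_edges c = insert {last c, hd c} (path_edges c)"

definition path_between :: "'a ugraph \<Rightarrow> 'a \<Rightarrow> 'a \<Rightarrow> 'a list \<Rightarrow> bool" where
  "path_between G u v p \<longleftrightarrow>
     p \<noteq> [] \<and> distinct p \<and> set p \<subseteq> verts G \<and> path_edges p \<subseteq> edges G \<and> hd p = u \<and> last p = v"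

definition shortest_path :: "'a ugraph \<Rightarrow> 'a \<Rightarrow> 'a \<Rightarrow> 'a list \<Rightarrow> bool" where
  "shortest_path G u v p \<longleftrightarrow>
     path_between G u v p \<and> (\<forall>q. path_between G u v q \<longrightarrow> length p \<le> length q)"

definition is_cycle :: "'a ugraph \<Rightarrow> 'a list \<Rightarrow> bool" where
  "is_cycle G c \<longleftrightarrow>
     3 \<le> length c \<and> distinct c \<and> set c \<subseteq> verts G \<and> cycle_edges c \<subseteq> edges G"

definition geodesic_cycle :: "'a ugraph \<Rightarrow> 'a list \<Rightarrow> bool" where
  "geodesic_cycle G c \<longleftrightarrow> is_cycle G c \<and>
     (\<forall>u\<in>set c. \<forall>v\<in>set c. \<exists>p. shortest_path G u v p \<and>
        set p \<subseteq> set c \<and> path_edges p \<subseteq> cycle_edges c)"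

(* Sets of edges are identified with their indicator functions into the two-element field. *)

definition bit_scale :: "bit \<Rightarrow> ('e \<Rightarrow> bit) \<Rightarrow> 'e \<Rightarrow> bit" where
  "bit_scale a f = (\<lambda>e. a * f e)"

global_interpretation edge_space: vector_space bit_scale
  by unfold_locales (auto simp: bit_scale_def fun_eq_iff algebra_simps)

definition cycle_space :: "'a ugraph \<Rightarrow> ('a set \<Rightarrow> bit) set" where
  "cycle_space G = edge_space.span {indicator (cycle_edges c) | c. is_cycle G c}"

definition cycle_space_gen :: "'a ugraph \<Rightarrow> nat" where
  "cycle_space_gen G =
     (LEAST l. edge_space.span {indicator (cycle_edges c) | c. is_cycle G c \<and> length c \<le> l}
               = cycle_space G)"

definition is_tree :: "'a ugraph \<Rightarrow> bool" where
  "is_tree T \<longleftrightarrow> simple_graph T \<and> verts T \<noteq> {} \<and>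
     (\<forall>u\<in>verts T. \<forall>v\<in>verts T. \<exists>p. path_between T u v p) \<and> (\<nexists>c. is_cycle T c)"

definition tree_decomposition :: "'a ugraph \<Rightarrow> 't ugraph \<Rightarrow> ('t \<Rightarrow> 'a set) \<Rightarrow> bool" where
  "tree_decomposition G T B \<longleftrightarrow> is_tree T \<and>
     (\<Union>t\<in>verts T. B t) = verts G \<and>
     (\<forall>e\<in>edges G. \<exists>t\<in>verts T. e \<subseteq> B t) \<and>
     (\<forall>r s p. path_between T r s p \<longrightarrow> (\<forall>t\<in>set p. B r \<inter> B s \<subseteq> B t))"

definition max_part_size :: "'t ugraph \<Rightarrow> ('t \<Rightarrow> 'a set) \<Rightarrow> nat" where
  "max_part_size T B = Max ((\<lambda>t. card (B t)) ` verts T)"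

(* Decomposition trees are finite, so taking their nodes to be natural numbers is no restriction.
   The value is an integer because the empty graph has tree-width -1. *)

definition tree_width :: "'a ugraph \<Rightarrow> int" where
  "tree_width G =
     int (LEAST n. \<exists>(T :: nat ugraph) B. tree_decomposition G T B \<and> max_part_size T B = n) - 1"

end

theory Submission imports Defs begin

text \<open>
  Let \<open>c\<close> be a geodesic cycle of length \<open>k\<close>, let \<open>l\<close> be the length up to which cycles are needed to
  generate the cycle space, and suppose that some tree-decomposition has only parts with at most
  \<open>n\<close> vertices, where \<open>(n - 1) l < k\<close>. The contradiction is that each part leaves a large piece of
  \<open>c\<close> in a single component of its complement, and that these pieces behave like a bramble which
  no part covers.

  Short cycles bind separators together. If \<open>D\<close> and \<open>D'\<close> are disjoint connected sets such that
  all neighbours of \<open>D'\<close> outside \<open>D'\<close> are in \<open>D\<close>, and the set \<open>N\<close> of vertices of \<open>D'\<close> with a neighbour in \<open>D\<close> is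
  split into two non-empty classes, then some cycle of length at most \<open>l\<close> meets both classes
  (\<open>cycle_through_attachments\<close>). For otherwise every short cycle, hence by linearity every cycle,
  would have an even number of edges between \<open>D\<close> and the first class; but a cycle that crosses once
  through each class has exactly one.

  Now fix a part \<open>X\<close> and partition it into clusters, the classes of the equivalence relation
  generated by lying on a common short cycle. A cluster with \<open>q\<close> vertices is covered by a closed
  walk of length at most \<open>(q - 1) l < k\<close>. Since distances between vertices of \<open>c\<close> are the same in \<open>c\<close>
  and in \<open>G\<close>, such a walk cannot wind around \<open>c\<close>, and the vertices of \<open>c\<close> on it lie on an arc
  with at most \<open>(q - 1) l / 2\<close> edges (\<open>closed_walk_in_arc\<close>). Let \<open>Y\<close> consist of the vertices of
  \<open>c\<close> outside all these arcs. Adding up, \<open>Y\<close> has more than \<open>k / 2 - 1\<close> vertices; and \<open>X\<close> does not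
  separate any two of them, because the relevant attachment set \<open>N\<close> would lie in one cluster,
  while removing a single arc does not disconnect \<open>c\<close> (\<open>large_side\<close>).

  Two sets of more than \<open>k / 2 - 1\<close> vertices of \<open>c\<close> intersect or are joined by an edge of
  \<open>c\<close> (\<open>large_subsets_touch\<close>). So for any two nodes of the decomposition tree, some part meets both
  of their sets \<open>Y\<close>. But each \<open>Y\<close> avoids its own part and therefore points to one branch of the
  tree at its node; following these directions in a finite tree ends at two adjacent nodes that
  point at each other, and their two branches are disjoint (\<open>tree_no_escaping_family\<close>).
\<close>

section \<open>Walks, paths and components\<close>

definition adj_on :: "'a ugraph \<Rightarrow> 'a set \<Rightarrow> ('a \<times> 'a) set" where
  "adj_on G A = {(u, v). u \<in> A \<and> v \<in> A \<and> {u, v} \<in> edges G}"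

definition component :: "'a ugraph \<Rightarrow> 'a set \<Rightarrow> 'a \<Rightarrow> 'a set" where
  "component G A y = {v. (y, v) \<in> (adj_on G A)\<^sup>*}"

lemma path_edges_append:
  assumes "xs \<noteq> []" "ys \<noteq> []"
  shows "path_edges (xs @ ys) = path_edges xs \<union> {{last xs, hd ys}} \<union> path_edges ys"
  using assms
proof (induction xs rule: path_edges.induct)
  case (1 x y xs)
  then show ?case by auto
next
  case ("2_2" v)
  then show ?case by (cases ys) auto
qed auto

text \<open>
  Cutting a walk at a vertex: both halves keep that vertex.
\<close>

lemma path_edges_join:
  "path_edges (xs @ x # ys) = path_edges (xs @ [x]) \<union> path_edges (x # ys)"
  by (cases "xs = []") (simp_all add: path_edges_append)

lemma path_edges_subset: "e \<in> path_edges p \<Longrightarrow> e \<subseteq> set p"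
  by (induction p rule: path_edges.induct) auto

lemma path_edges_nth:
  assumes "Suc i < length p"
  shows "{p ! i, p ! Suc i} \<in> path_edges p"
  using assms
proof (induction p arbitrary: i rule: path_edges.induct)
  case (1 x y xs)
  then show ?case by (cases i) auto
qed auto

lemma path_edgeE:
  assumes "e \<in> path_edges p"
  obtains i where "Suc i < length p" "e = {p ! i, p ! Suc i}"
  using assms
proof (induction p arbitrary: thesis rule: path_edges.induct)
  case (1 x y xs)
  show ?case
  proof (cases "e = {x, y}")
    case True
    then show ?thesis using 1(2)[of 0] by simp
  next
    case False
    then obtain i where "Suc i < length (y # xs)" "e = {(y # xs) ! i, (y # xs) ! Suc i}"
      using 1(1,3) by auto
    then show ?thesis using 1(2)[of "Suc i"] by simp
  qed
qed auto

lemma finite_path_edges [simp]: "finite (path_edges p)"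
  by (induction p rule: path_edges.induct) auto

lemma finite_edges: "simple_graph G \<Longrightarrow> finite (edges G)"
  by (rule finite_subset[of _ "Pow (verts G)"]) (auto simp: simple_graph_def)

lemma sym_adj_on: "sym (adj_on G A)"
  by (auto simp: adj_on_def sym_def insert_commute)

lemma conn_sym: "(u, v) \<in> (adj_on G A)\<^sup>* \<Longrightarrow> (v, u) \<in> (adj_on G A)\<^sup>*"
  using sym_rtrancl[OF sym_adj_on] by (rule symD)

lemma walk_to_path:
  assumes "(u, v) \<in> adj_on G A ^^ m" "u \<in> A"
  obtains p where "p \<noteq> []" "distinct p" "hd p = u" "last p = v" "set p \<subseteq> A"
    "path_edges p \<subseteq> edges G" "length p \<le> Suc m"
proof -
  from assms(1) have "\<exists>p. p \<noteq> [] \<and> distinct p \<and> hd p = u \<and> last p = v \<and> set p \<subseteq> A \<and>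
    path_edges p \<subseteq> edges G \<and> length p \<le> Suc m"
  proof (induction m arbitrary: v)
    case 0
    then show ?case using assms(2) by (intro exI[of _ "[u]"]) auto
  next
    case (Suc m)
    then obtain w where w: "(u, w) \<in> adj_on G A ^^ m" "(w, v) \<in> adj_on G A" by auto
    from Suc.IH[OF w(1)] obtain p where p: "p \<noteq> []" "distinct p" "hd p = u" "last p = w"
      "set p \<subseteq> A" "path_edges p \<subseteq> edges G" "length p \<le> Suc m" by blast
    show ?case
    \<comment> \<open>If the walk returns to the path, the path is cut back to the first visit.\<close>
    proof (cases "v \<in> set p")
      case True
      then obtain as bs where ab: "p = as @ v # bs" by (meson split_list)
      have "path_edges (as @ [v]) \<subseteq> edges G"
        using p(6) unfolding ab path_edges_join[of as v bs] by blast
      moreover have "hd (as @ [v]) = u" using p(3) ab by (cases as) auto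
      ultimately show ?thesis using p ab by (intro exI[of _ "as @ [v]"]) auto
    next
      case False
      then show ?thesis using p w(2)
        by (intro exI[of _ "p @ [v]"]) (auto simp: path_edges_append adj_on_def)
    qed
  qed
  then show ?thesis using that by blast
qed

lemma conn_to_path:
  assumes "(u, v) \<in> (adj_on G A)\<^sup>*" "u \<in> A"
  obtains p where "p \<noteq> []" "distinct p" "hd p = u" "last p = v" "set p \<subseteq> A"
    "path_edges p \<subseteq> edges G"
  using assms walk_to_path by (metis rtrancl_power)

lemma path_to_walk:
  assumes "p \<noteq> []" "set p \<subseteq> A" "path_edges p \<subseteq> edges G"
  shows "(hd p, last p) \<in> (adj_on G A)\<^sup>*"
  using assms
proof (induction p rule: path_edges.induct)
  case (1 x y xs)
  then have "(x, y) \<in> adj_on G A" "(y, last (y # xs)) \<in> (adj_on G A)\<^sup>*"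
    by (auto simp: adj_on_def)
  then show ?case by (simp add: converse_rtrancl_into_rtrancl)
qed auto

lemma adj_on_mono: "A \<subseteq> B \<Longrightarrow> adj_on G A \<subseteq> adj_on G B"
  by (auto simp: adj_on_def)

lemma component_subset: "y \<in> A \<Longrightarrow> component G A y \<subseteq> A"
proof
  fix v assume "y \<in> A" "v \<in> component G A y"
  then have "(y, v) \<in> (adj_on G A)\<^sup>*" by (simp add: component_def)
  then show "v \<in> A" using \<open>y \<in> A\<close> by (induction) (auto simp: adj_on_def)
qed

lemma component_self: "y \<in> component G A y"
  by (simp add: component_def)

lemma component_connected:
  assumes "u \<in> component G A y" "v \<in> component G A y"
  shows "(u, v) \<in> (adj_on G (component G A y))\<^sup>*"
proof -
  have *: "(y, v) \<in> (adj_on G (component G A y))\<^sup>*" if "v \<in> component G A y" for v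
  proof -
    from that have "(y, v) \<in> (adj_on G A)\<^sup>*" by (simp add: component_def)
    then show ?thesis
    proof (induction)
      case (step a b)
      have "a \<in> component G A y" using step.hyps(1) by (simp add: component_def)
      moreover have "b \<in> component G A y"
        using step.hyps by (simp add: component_def)
      ultimately have "(a, b) \<in> adj_on G (component G A y)"
        using step.hyps(2) by (auto simp: adj_on_def)
      with step.IH show ?case by simp
    qed simp
  qed
  show ?thesis using conn_sym[OF *[OF assms(1)]] *[OF assms(2)] by simp
qed

lemma component_neighbour:
  assumes "y \<in> A" "u \<in> component G A y" "{u, v} \<in> edges G" "v \<in> A"
  shows "v \<in> component G A y"
proof -
  have "(u, v) \<in> adj_on G A" using assms component_subset[OF assms(1)] by (auto simp: adj_on_def)
  then show ?thesis using assms(2) by (auto simp: component_def)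
qed

section \<open>Parity of cycles on edge sets\<close>

text \<open>
  This needs length at least three: the vertex sequence of a single edge would close up along that
  same edge.
\<close>

lemma cycle_edges_closing:
  assumes "distinct c" "3 \<le> length c"
  shows "{last c, hd c} \<notin> path_edges c"
proof -
  obtain x y zs where c: "c = x # y # zs" "zs \<noteq> []"
    using assms(2) by (cases c; cases "tl c") (auto simp: Suc_le_eq)
  have "{last c, x} \<notin> path_edges (y # zs)"
    using path_edges_subset[of "{last c, x}" "y # zs"] assms(1) c by auto
  moreover have "last zs \<in> set zs" using c(2) by simp
  then have "{last c, x} \<noteq> {x, y}" using assms(1) c by (auto simp: doubleton_eq_iff)
  ultimately show ?thesis using c by auto
qed

text \<open>
  All potential edges across the boundary of \<open>S\<close>, independent of a graph; a path or cycle then meets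
  the cut in the intersection with its edge set.
\<close>

definition edge_cut :: "'a set \<Rightarrow> 'a set set" where
  "edge_cut S = {e. \<exists>u v. e = {u, v} \<and> u \<in> S \<and> v \<notin> S}"

lemma doubleton_in_cut: "{u, v} \<in> edge_cut S \<longleftrightarrow> (u \<in> S) \<noteq> (v \<in> S)"
  by (auto simp: edge_cut_def doubleton_eq_iff)

lemma path_cut_parity:
  assumes "distinct p" "p \<noteq> []"
  shows "odd (card (path_edges p \<inter> edge_cut S)) \<longleftrightarrow> (hd p \<in> S) \<noteq> (last p \<in> S)"
  using assms
proof (induction p rule: path_edges.induct)
  case (1 x y xs)
  have "{x, y} \<notin> path_edges (y # xs)"
    using path_edges_subset[of "{x, y}" "y # xs"] 1(2) by auto
  then have "card (path_edges (x # y # xs) \<inter> edge_cut S) =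
      (if {x, y} \<in> edge_cut S then 1 else 0) + card (path_edges (y # xs) \<inter> edge_cut S)"
    by (auto simp: Int_insert_left)
  then show ?case using 1 by (auto simp: doubleton_in_cut)
qed auto

lemma cycle_cut_even:
  assumes "is_cycle G c"
  shows "even (card (cycle_edges c \<inter> edge_cut S))"
proof -
  have c: "distinct c" "3 \<le> length c" "c \<noteq> []" using assms by (auto simp: is_cycle_def)
  have "card (cycle_edges c \<inter> edge_cut S) =
      (if {last c, hd c} \<in> edge_cut S then 1 else 0) + card (path_edges c \<inter> edge_cut S)"
    using cycle_edges_closing[OF c(1,2)] by (auto simp: cycle_edges_def Int_insert_left)
  then show ?thesis using path_cut_parity[OF c(1,3), of S] by (auto simp: doubleton_in_cut)
qed

text \<open>
  The least length in the definition is attained because no cycle is longer than the number of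
  vertices.
\<close>

lemma cycle_space_gen_spans:
  assumes "simple_graph G"
  shows "edge_space.span {indicator (cycle_edges c) | c. is_cycle G c \<and> length c \<le> cycle_space_gen G}
    = cycle_space G"
  unfolding cycle_space_gen_def
proof (rule LeastI)
  have "length c \<le> card (verts G)" if "is_cycle G c" for c
    using that assms card_mono[of "verts G" "set c"] distinct_card[of c]
    by (simp add: is_cycle_def simple_graph_def)
  then have "is_cycle G c \<and> length c \<le> card (verts G) \<longleftrightarrow> is_cycle G c" for c by blast
  then show "edge_space.span {indicator (cycle_edges c) | c. is_cycle G c \<and> length c \<le> card (verts G)}
    = cycle_space G"
    by (simp add: cycle_space_def)
qed

lemma sum_indicator_bit:
  assumes "finite F"
  shows "(\<Sum>e\<in>F. indicator Z e :: bit) = 0 \<longleftrightarrow> even (card (Z \<inter> F))"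
proof -
  have "(\<Sum>e\<in>F. indicator Z e :: bit) = (\<Sum>e\<in>Z \<inter> F. 1)"
    by (rule sum.mono_neutral_cong_right) (auto simp: assms indicator_def)
  also have "\<dots> = of_nat (card (Z \<inter> F))" by simp
  finally show ?thesis by (simp only: Z2.bit_eq_iff even_of_nat_iff even_zero) simp
qed

text \<open>
  Counting the edges of \<open>F\<close> modulo two is a linear functional on edge sets. If it vanished on all short
  cycles, it would vanish on their span, which contains every cycle.
\<close>

lemma short_odd_cycle:
  assumes "simple_graph G" "finite F" "is_cycle G c" "odd (card (cycle_edges c \<inter> F))"
  obtains z where "is_cycle G z" "length z \<le> cycle_space_gen G" "odd (card (cycle_edges z \<inter> F))"
proof (rule ccontr)
  assume neg: "\<not> thesis"
  let ?K = "{f :: 'a set \<Rightarrow> bit. (\<Sum>e\<in>F. f e) = 0}"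
  let ?S = "{indicator (cycle_edges c) | c. is_cycle G c \<and> length c \<le> cycle_space_gen G}"
  have "edge_space.subspace ?K"
    unfolding edge_space.subspace_def mem_Collect_eq bit_scale_def plus_fun_def zero_fun_def
      sum.distrib sum_distrib_left[symmetric] by simp
  moreover have "?S \<subseteq> ?K"
    using neg that by (fastforce simp: sum_indicator_bit assms(2))
  ultimately have "edge_space.span ?S \<subseteq> ?K" by (rule edge_space.span_minimal[rotated])
  moreover have "indicator (cycle_edges c) \<in> edge_space.span ?S"
    unfolding cycle_space_gen_spans[OF assms(1)] cycle_space_def
    using assms(3) by (intro edge_space.span_base) auto
  ultimately have "(\<Sum>e\<in>F. indicator (cycle_edges c) e :: bit) = 0" by auto
  with assms(2,4) show False by (simp add: sum_indicator_bit)
qed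

text \<open>
  A cycle has odd intersection with any one of its own edges.
\<close>

lemma cycle_space_gen_ge_3:
  assumes "simple_graph G" "is_cycle G c"
  shows "3 \<le> cycle_space_gen G"
proof -
  have "cycle_edges c \<inter> {{last c, hd c}} = {{last c, hd c}}" by (auto simp: cycle_edges_def)
  then have "odd (card (cycle_edges c \<inter> {{last c, hd c}}))" by simp
  from short_odd_cycle[OF assms(1) _ assms(2) this] obtain z
    where "is_cycle G z" "length z \<le> cycle_space_gen G" by auto
  then show ?thesis by (auto simp: is_cycle_def)
qed

section \<open>Separators are held together by short cycles\<close>

text \<open>
  Let \<open>F\<close> be the set of edges from \<open>T\<close> to \<open>D\<close>. A path through \<open>D\<close> and a path through \<open>D'\<close>, joined by
  one edge at \<open>T\<close> and one edge at \<open>N - T\<close>, form a cycle with exactly one edge in \<open>F\<close>. Hence some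
  short cycle also has an odd number of edges in \<open>F\<close>. If it avoided \<open>N - T\<close>, then \<open>F\<close> would
  contain all its edges leaving \<open>D'\<close>, and their number is even.
\<close>

lemma cycle_through_attachments:
  assumes G: "simple_graph G"
    and D: "\<forall>u\<in>D. \<forall>v\<in>D. (u, v) \<in> (adj_on G D)\<^sup>*" "D \<subseteq> verts G"
    and D': "\<forall>u\<in>D'. \<forall>v\<in>D'. (u, v) \<in> (adj_on G D')\<^sup>*" "D' \<subseteq> verts G"
    and disj: "D \<inter> D' = {}"
    and out: "\<forall>u\<in>D'. \<forall>v. {u, v} \<in> edges G \<longrightarrow> v \<in> D \<union> D'"
    and N: "N = {u \<in> D'. \<exists>v \<in> D. {u, v} \<in> edges G}"
    and T: "T \<subseteq> N" "T \<noteq> {}" "T \<noteq> N"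
  obtains z u v where "is_cycle G z" "length z \<le> cycle_space_gen G"
    "u \<in> set z" "v \<in> set z" "u \<in> T" "v \<in> N - T"
proof -
  define F where "F = {{u, v} | u v. u \<in> T \<and> v \<in> D \<and> {u, v} \<in> edges G}"
  have "finite F" using finite_edges[OF G] by (rule finite_subset[rotated]) (auto simp: F_def)
  obtain x1 x2 where x: "x1 \<in> T" "x2 \<in> N - T" using T by blast
  then obtain d1 d2 where d: "d1 \<in> D" "{x1, d1} \<in> edges G" "d2 \<in> D" "{x2, d2} \<in> edges G"
    using T(1) N by blast
  have xD: "x1 \<in> D'" "x2 \<in> D'" using x T(1) N by auto
  obtain p where p: "p \<noteq> []" "distinct p" "hd p = d1" "last p = d2" "set p \<subseteq> D"
    "path_edges p \<subseteq> edges G" using conn_to_path[OF D(1)[rule_format, OF d(1,3)] d(1)] by blast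
  obtain q where q: "q \<noteq> []" "distinct q" "hd q = x2" "last q = x1" "set q \<subseteq> D'"
    "path_edges q \<subseteq> edges G" using conn_to_path[OF D'(1)[rule_format, OF xD(2,1)] xD(2)] by blast
  have ce: "cycle_edges (p @ q) = {{x1, d1}, {x2, d2}} \<union> path_edges p \<union> path_edges q"
    using p q by (auto simp: cycle_edges_def path_edges_append insert_commute)
  have "length q \<ge> 2" using q x by (cases q; cases "tl q") auto
  moreover have "length p \<ge> 1" using p(1) by (simp add: Suc_le_eq)
  ultimately have "is_cycle G (p @ q)"
    using p q d ce disj D(2) D'(2) by (auto simp: is_cycle_def insert_commute)
  moreover have "cycle_edges (p @ q) \<inter> F = {{x1, d1}}"
  proof -
    have "{x1, d1} \<in> F" using x d by (auto simp: F_def)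
    moreover have "{x2, d2} \<notin> F"
      using x d disj T(1) N by (auto simp: F_def doubleton_eq_iff)
    moreover have "e \<notin> F" if "e \<in> path_edges p" for e
      using path_edges_subset[OF that] p(5) disj T(1) N by (auto simp: F_def)
    moreover have "e \<notin> F" if "e \<in> path_edges q" for e
      using path_edges_subset[OF that] q(5) disj T(1) N by (auto simp: F_def)
    ultimately show ?thesis unfolding ce by blast
  qed
  then have "odd (card (cycle_edges (p @ q) \<inter> F))" by simp
  ultimately obtain z where z: "is_cycle G z" "length z \<le> cycle_space_gen G"
    "odd (card (cycle_edges z \<inter> F))"
    using short_odd_cycle[OF G \<open>finite F\<close>] by blast
  have ends: "e \<subseteq> set z" if "e \<in> cycle_edges z" for e
  proof -
    have "z \<noteq> []" using z(1) by (auto simp: is_cycle_def)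
    then show ?thesis using that path_edges_subset[of e z] by (auto simp: cycle_edges_def)
  qed
  have "cycle_edges z \<inter> F \<noteq> {}" using z(3) by auto
  then obtain u where u: "u \<in> T" "u \<in> set z" using ends by (fastforce simp: F_def)
  have "\<exists>v. v \<in> N - T \<and> v \<in> set z"
  proof (rule ccontr)
    assume no: "\<not> ?thesis"
    have "cycle_edges z \<inter> edge_cut D' = cycle_edges z \<inter> F"
    proof (intro set_eqI iffI)
      fix e assume e: "e \<in> cycle_edges z \<inter> edge_cut D'"
      then obtain a b where ab: "e = {a, b}" "a \<in> D'" "b \<notin> D'" by (auto simp: edge_cut_def)
      have "e \<in> edges G" using e z(1) by (auto simp: is_cycle_def)
      then have "b \<in> D" using out ab by blast
      then have "a \<in> N" using N ab \<open>e \<in> edges G\<close> by blast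
      moreover have "a \<in> set z" using ends[of e] e ab by auto
      ultimately have "a \<in> T" using no by blast
      then show "e \<in> cycle_edges z \<inter> F" using e ab \<open>b \<in> D\<close> \<open>e \<in> edges G\<close> by (auto simp: F_def)
    next
      fix e assume "e \<in> cycle_edges z \<inter> F"
      then show "e \<in> cycle_edges z \<inter> edge_cut D'"
        using T(1) N disj by (auto simp: F_def edge_cut_def)
    qed
    then show False using cycle_cut_even[OF z(1), of D'] z(3) by simp
  qed
  then show ?thesis using that z u by blast
qed

text \<open>
  The walk is interrupted at \<open>u\<close> for one full turn around \<open>z\<close>.
\<close>

lemma detour_through_cycle:
  assumes xs: "path_edges xs \<subseteq> edges G" "u \<in> set xs"
    and z: "is_cycle G z" "u \<in> set z"
  obtains ys where "path_edges ys \<subseteq> edges G" "hd ys = hd xs" "last ys = last xs"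
    "set ys = set xs \<union> set z" "length ys = length xs + length z"
proof -
  obtain as bs where ab: "xs = as @ u # bs" using xs(2) by (meson split_list)
  obtain cs ds where cd: "z = cs @ u # ds" using z(2) by (meson split_list)
  have zE: "path_edges (cs @ u # ds) \<subseteq> edges G" "{last (u # ds), hd (cs @ [u])} \<in> edges G"
    using z(1) unfolding is_cycle_def cycle_edges_def cd by (cases cs; auto)+
  have 1: "path_edges (cs @ [u]) \<subseteq> edges G" "path_edges (u # ds) \<subseteq> edges G"
    using zE(1) path_edges_join[of cs u ds] by auto
  have 2: "path_edges (as @ [u]) \<subseteq> edges G" "path_edges (u # bs) \<subseteq> edges G"
    using xs(1) path_edges_join[of as u bs] ab by auto
  define ys where "ys = as @ u # (ds @ cs) @ u # bs"
  have "path_edges ((u # ds) @ (cs @ [u])) \<subseteq> edges G"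
    using 1 zE(2) by (subst path_edges_append) auto
  then have "path_edges (((u # ds) @ cs) @ u # bs) \<subseteq> edges G"
    using 2(2) by (subst path_edges_join) auto
  then have "path_edges ys \<subseteq> edges G"
    using 2(1) unfolding ys_def by (subst path_edges_join) auto
  moreover have "hd ys = hd xs" "last ys = last xs" "set ys = set xs \<union> set z"
    "length ys = length xs + length z"
    unfolding ys_def ab cd by (cases as; cases bs; auto)+
  ultimately show ?thesis using that by blast
qed

text \<open>
  Starting with the trivial walk at \<open>x\<close>, each detour around a short cycle reaches at least one further
  vertex of \<open>Q\<close>, so \<open>card Q - 1\<close> detours suffice.
\<close>

lemma closed_walk_through_cluster:
  assumes "finite Q" "x \<in> Q"
    and link: "\<And>T. T \<subseteq> Q \<Longrightarrow> T \<noteq> {} \<Longrightarrow> T \<noteq> Q \<Longrightarrow>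
      \<exists>u\<in>T. \<exists>v\<in>Q - T. \<exists>z. is_cycle G z \<and> length z \<le> l \<and> u \<in> set z \<and> v \<in> set z"
  obtains xs where "path_edges xs \<subseteq> edges G" "xs \<noteq> []" "hd xs = x" "last xs = x" "Q \<subseteq> set xs"
    "length xs \<le> (card Q - 1) * l + 1"
proof -
  have "\<exists>T xs. T \<subseteq> Q \<and> card T = Suc n \<and> path_edges xs \<subseteq> edges G \<and> xs \<noteq> [] \<and>
      hd xs = x \<and> last xs = x \<and> T \<subseteq> set xs \<and> length xs \<le> n * l + 1" if "n < card Q" for n
    using that
  proof (induction n)
    case 0
    show ?case using assms(2) by (intro exI[of _ "{x}"] exI[of _ "[x]"]) auto
  next
    case (Suc n)
    then obtain T xs where T: "T \<subseteq> Q" "card T = Suc n" and xs: "path_edges xs \<subseteq> edges G"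
      "xs \<noteq> []" "hd xs = x" "last xs = x" "T \<subseteq> set xs" "length xs \<le> n * l + 1" by auto
    have "T \<noteq> {}" "T \<noteq> Q" using T Suc.prems by auto
    then obtain u v z where u: "u \<in> T" "v \<in> Q - T" "is_cycle G z" "length z \<le> l"
      "u \<in> set z" "v \<in> set z" using link[OF T(1)] by blast
    then have "u \<in> set xs" using xs(5) by blast
    then obtain ys where ys: "path_edges ys \<subseteq> edges G" "hd ys = hd xs" "last ys = last xs"
      "set ys = set xs \<union> set z" "length ys = length xs + length z"
      using detour_through_cycle[OF xs(1) _ u(3,5)] by blast
    have "finite T" using T(1) assms(1) finite_subset by blast
    then have "card (insert v T) = Suc (Suc n)" using T(2) u(2) by simp
    moreover have "ys \<noteq> []" using ys(4) u(5) by auto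
    ultimately show ?case using T xs u ys
      by (intro exI[of _ "insert v T"] exI[of _ ys]) auto
  qed
  moreover have "card Q - 1 < card Q" "Suc (card Q - 1) = card Q"
    using assms(1,2) card_gt_0_iff[of Q] by auto
  ultimately obtain T xs where T: "T \<subseteq> Q" "card T = card Q" and xs: "path_edges xs \<subseteq> edges G"
      "xs \<noteq> []" "hd xs = x" "last xs = x" "T \<subseteq> set xs" "length xs \<le> (card Q - 1) * l + 1"
    by metis
  have "T = Q" using T assms(1) card_subset_eq by blast
  then show ?thesis using that xs by blast
qed

section \<open>Walks near a geodesic cycle\<close>

text \<open>
  The vertices of a cycle are indexed periodically by all integers. An arc is then the image of an
  integer interval, and walks along the cycle can be lifted to the integer line.
\<close>

definition cyc :: "'a list \<Rightarrow> int \<Rightarrow> 'a" where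
  "cyc c i = c ! nat (i mod int (length c))"

lemma cyc_in_set: "c \<noteq> [] \<Longrightarrow> cyc c i \<in> set c"
  unfolding cyc_def by (intro nth_mem) (simp add: nat_less_iff)

lemma cyc_eq_iff:
  assumes "distinct c" "c \<noteq> []"
  shows "cyc c i = cyc c j \<longleftrightarrow> i mod int (length c) = j mod int (length c)"
  using assms by (simp add: cyc_def nth_eq_iff_index_eq nat_less_iff eq_nat_nat_iff)

lemma cyc_of_nat: "i < length c \<Longrightarrow> cyc c (int i) = c ! i"
  by (simp add: cyc_def)

lemma in_set_cycE:
  assumes "v \<in> set c"
  obtains i where "v = cyc c i" "a \<le> i" "i < a + int (length c)"
proof -
  obtain j where j: "j < length c" "v = c ! j" using assms by (auto simp: in_set_conv_nth)
  define i where "i = a + (int j - a) mod int (length c)"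
  have "i mod int (length c) = int j mod int (length c)" by (simp add: i_def mod_simps)
  then have "cyc c i = v" using j cyc_of_nat[of j c] by (simp add: cyc_def)
  moreover have "a \<le> i" "i < a + int (length c)"
    using pos_mod_bound[of "int (length c)" "int j - a"] pos_mod_sign[of "int (length c)" "int j - a"] j(1)
    unfolding i_def by linarith+
  ultimately show ?thesis using that by blast
qed

lemma cyc_add_length [simp]: "cyc c (i + int (length c)) = cyc c i"
  by (simp add: cyc_def)

lemma cycle_edges_cyc:
  assumes "c \<noteq> []"
  shows "e \<in> cycle_edges c \<Longrightarrow> \<exists>i. e = {cyc c i, cyc c (i + 1)}"
    and "2 \<le> length c \<Longrightarrow> {cyc c i, cyc c (i + 1)} \<in> cycle_edges c"
proof -
  let ?k = "length c"
  have last: "last c = cyc c (int ?k - 1)" "hd c = cyc c (int ?k)"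
    using assms cyc_of_nat[of "?k - 1" c] cyc_of_nat[of 0 c] cyc_add_length[of c 0]
    by (auto simp: last_conv_nth hd_conv_nth Suc_le_eq)
  show "\<exists>i. e = {cyc c i, cyc c (i + 1)}" if "e \<in> cycle_edges c"
  proof (cases "e \<in> path_edges c")
    case True
    then obtain i where i: "Suc i < ?k" "e = {c ! i, c ! Suc i}" by (rule path_edgeE)
    then show ?thesis using cyc_of_nat[of i c] cyc_of_nat[of "Suc i" c]
      by (intro exI[of _ "int i"]) (auto simp: add.commute)
  next
    case False
    then show ?thesis using that last by (intro exI[of _ "int ?k - 1"]) (auto simp: cycle_edges_def)
  qed
  show "{cyc c i, cyc c (i + 1)} \<in> cycle_edges c" if "2 \<le> length c"
  proof -
    define j where "j = nat (i mod int ?k)"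
    have j: "j < ?k" "int j = i mod int ?k" using assms by (auto simp: j_def nat_less_iff)
    have eq: "cyc c i = cyc c (int j)" "cyc c (i + 1) = cyc c (int j + 1)"
      by (auto simp: cyc_def j(2) mod_simps)
    show ?thesis
    proof (cases "Suc j = ?k")
      case True
      then have "int j = int ?k - 1" by auto
      then show ?thesis unfolding eq using last by (simp add: cycle_edges_def)
    next
      case False
      then have "Suc j < ?k" using j by simp
      then show ?thesis unfolding eq using path_edges_nth[of j c] j(1) cyc_of_nat[of j c]
          cyc_of_nat[of "Suc j" c] by (simp add: cycle_edges_def add.commute)
    qed
  qed
qed

text \<open>
  Each edge of the cycle changes the index by one, in one of the two directions.
\<close>

lemma path_lift:
  assumes "distinct c" "c \<noteq> []" "path_edges p \<subseteq> cycle_edges c" "p \<noteq> []" "hd p = cyc c a"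
  shows "\<exists>b. cyc c b = last p \<and> \<bar>b - a\<bar> < int (length p)"
  using assms(3-)
proof (induction p arbitrary: a rule: path_edges.induct)
  case (1 x y xs)
  then have "{x, y} \<in> cycle_edges c" by auto
  then obtain i where "{x, y} = {cyc c i, cyc c (i + 1)}"
    using cycle_edges_cyc(1)[OF assms(2)] by blast
  then obtain s :: int where s: "\<bar>s\<bar> \<le> 1" "y = cyc c (a + s)"
  proof (cases "x = cyc c i \<and> y = cyc c (i + 1)")
    case True
    then have "i mod int (length c) = a mod int (length c)"
      using 1(4) cyc_eq_iff[OF assms(1,2)] by simp
    then have "(i + 1) mod int (length c) = (a + 1) mod int (length c)" by (metis mod_add_left_eq)
    then show ?thesis using that[of 1] True by (simp add: cyc_def)
  next
    case False
    then have e: "y = cyc c i" "x = cyc c (i + 1)"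
      using \<open>{x, y} = {cyc c i, cyc c (i + 1)}\<close> by (auto simp: doubleton_eq_iff)
    then have "(i + 1) mod int (length c) = a mod int (length c)"
      using 1(4) cyc_eq_iff[OF assms(1,2)] by simp
    then have "(i + 1 - 1) mod int (length c) = (a - 1) mod int (length c)" by (metis mod_diff_left_eq)
    then show ?thesis using that[of "-1"] e by (simp add: cyc_def)
  qed
  obtain b where "cyc c b = last (y # xs)" "\<bar>b - (a + s)\<bar> < int (length (y # xs))"
    using 1(1)[of "a + s"] 1(2) s by auto
  then show ?case using s by (intro exI[of _ b]) auto
qed (auto intro: exI[of _ a for a])

text \<open>
  This is how geodesicity is used: a walk in \<open>G\<close> between vertices of the cycle can be replaced by a
  path that is no longer and runs on the cycle, and that path has a lift.
\<close>

lemma geodesic_lift: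
  assumes c: "geodesic_cycle G c" and w: "(cyc c a, v) \<in> adj_on G UNIV ^^ m" "v \<in> set c"
    and G: "simple_graph G"
  obtains b where "cyc c b = v" "\<bar>b - a\<bar> \<le> int m"
proof -
  have c': "distinct c" "c \<noteq> []" "set c \<subseteq> verts G"
    using c by (auto simp: geodesic_cycle_def is_cycle_def)
  have u: "cyc c a \<in> set c" using c' by (simp add: cyc_in_set)
  have "adj_on G UNIV = adj_on G (verts G)"
    using G by (auto simp: adj_on_def simple_graph_def)
  then obtain q where q: "q \<noteq> []" "distinct q" "hd q = cyc c a" "last q = v" "set q \<subseteq> verts G"
    "path_edges q \<subseteq> edges G" "length q \<le> Suc m"
    using walk_to_path[of "cyc c a" v m G "verts G"] w u c'(3) by auto
  obtain p where p: "shortest_path G (cyc c a) v p" "path_edges p \<subseteq> cycle_edges c"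
    using c u w(2) unfolding geodesic_cycle_def by blast
  then have "length p \<le> Suc m" using q
    by (auto simp: shortest_path_def path_between_def intro: order_trans)
  moreover have "p \<noteq> []" "hd p = cyc c a" "last p = v"
    using p by (auto simp: shortest_path_def path_between_def)
  ultimately show ?thesis using path_lift[OF c'(1,2) p(2), of a] that by force
qed

text \<open>
  The visits of a walk to the cycle are lifted one after the other. At any time \<open>b\<close> is the lift of the
  latest visit, \<open>m\<close> counts the steps made since then, and all lifts used so far lie between \<open>lo\<close> and \<open>hi\<close>.
  The quantity \<open>2 * (hi - lo) - \<bar>b - a\<bar>\<close> is the least length of a walk on the integer
  line from \<open>a\<close> to \<open>b\<close> that visits both \<open>lo\<close> and \<open>hi\<close>. It grows by at most the distance between
  consecutive lifts, which makes the bound inductive. The inequality is strict as a list of \<open>n\<close> vertices makes only \<open>n - 1\<close> steps.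
\<close>

lemma walk_lift:
  assumes c: "geodesic_cycle G c" and G: "simple_graph G"
    and xs: "path_edges xs \<subseteq> edges G" "xs \<noteq> []" "hd xs = cyc c a"
  shows "\<exists>b lo hi m. lo \<le> a \<and> a \<le> hi \<and> lo \<le> b \<and> b \<le> hi \<and>
    (cyc c b, last xs) \<in> adj_on G UNIV ^^ m \<and> (last xs \<in> set c \<longrightarrow> m = 0) \<and>
    int m + 2 * (hi - lo) - \<bar>b - a\<bar> < int (length xs) \<and> set xs \<inter> set c \<subseteq> cyc c ` {lo..hi}"
  using xs
proof (induction xs rule: rev_induct)
  case (snoc v xs)
  show ?case
  proof (cases "xs = []")
    case True
    then show ?thesis using snoc by (intro exI[of _ a] exI[of _ "0::nat"]) auto
  next
    case False
    then have E: "path_edges xs \<subseteq> edges G" "{last xs, v} \<in> edges G" "hd xs = cyc c a"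
      using snoc.prems by (auto simp: path_edges_append)
    obtain b lo hi m where IH: "lo \<le> a" "a \<le> hi" "lo \<le> b" "b \<le> hi"
      "(cyc c b, last xs) \<in> adj_on G UNIV ^^ m"
      "int m + 2 * (hi - lo) - \<bar>b - a\<bar> < int (length xs)" "set xs \<inter> set c \<subseteq> cyc c ` {lo..hi}"
      using snoc.IH[OF E(1) False E(3)] by blast
    have w: "(cyc c b, v) \<in> adj_on G UNIV ^^ Suc m"
      using IH(5) E(2) by (auto simp: adj_on_def)
    show ?thesis
    proof (cases "v \<in> set c")
      case False
      then have "set (xs @ [v]) \<inter> set c \<subseteq> cyc c ` {lo..hi}" using IH(7) by auto
      then show ?thesis using IH w False
        by - (rule exI[of _ b], rule exI[of _ lo], rule exI[of _ hi], rule exI[of _ "Suc m"],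
          auto simp del: relpow.simps)
    next
      case True
      then obtain b' where b': "cyc c b' = v" "\<bar>b' - b\<bar> \<le> int (Suc m)"
        using geodesic_lift[OF c w _ G] by blast
      have "set (xs @ [v]) \<inter> set c \<subseteq> insert v (cyc c ` {lo..hi})" using IH(7) by auto
      also have "\<dots> \<subseteq> cyc c ` {min lo b'..max hi b'}" using b'(1) by fastforce
      finally have "set (xs @ [v]) \<inter> set c \<subseteq> cyc c ` {min lo b'..max hi b'}" .
      moreover have "2 * (max hi b' - min lo b') - \<bar>b' - a\<bar> < int (length xs) + 1"
        using IH(1-4,6) b'(2) by (simp add: max_def min_def abs_if split: if_splits)
      ultimately show ?thesis using IH(1-4) b'(1)
        by - (rule exI[of _ b'], rule exI[of _ "min lo b'"], rule exI[of _ "max hi b'"],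
          rule exI[of _ 0], auto)
    qed
  qed
qed simp

text \<open>
  A closed walk has lifts \<open>a\<close> and \<open>b\<close> of its two ends that agree modulo the length of the cycle. If the
  walk is shorter than the cycle, then \<open>a = b\<close>, so it travels twice across the interval of its lifts.
\<close>

lemma closed_walk_in_arc:
  assumes c: "geodesic_cycle G c" and G: "simple_graph G"
    and xs: "path_edges xs \<subseteq> edges G" "xs \<noteq> []" "hd xs \<in> set c" "last xs = hd xs"
    and short: "length xs \<le> length c"
  obtains lo hi where "lo \<le> hi" "2 * (hi - lo) < int (length xs)"
    "set xs \<inter> set c \<subseteq> cyc c ` {lo..hi}"
proof -
  have c': "distinct c" "c \<noteq> []"
    using c by (auto simp: geodesic_cycle_def is_cycle_def)
  obtain a where a: "hd xs = cyc c a" using in_set_cycE[OF xs(3)] by metis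
  obtain b lo hi m where b: "lo \<le> a" "a \<le> hi" "lo \<le> b" "b \<le> hi"
    "(cyc c b, last xs) \<in> adj_on G UNIV ^^ m" "last xs \<in> set c \<longrightarrow> m = 0"
    "int m + 2 * (hi - lo) - \<bar>b - a\<bar> < int (length xs)" "set xs \<inter> set c \<subseteq> cyc c ` {lo..hi}"
    using walk_lift[OF c G xs(1,2) a] by blast
  have "m = 0" using b(6) xs(3,4) by simp
  then have b': "cyc c b = last xs" "2 * (hi - lo) - \<bar>b - a\<bar> < int (length xs)"
    using b(5,7) by auto
  have "\<bar>b - a\<bar> \<le> hi - lo" using b(1-4) by auto
  then have "\<bar>b - a\<bar> < int (length c)" using b'(2) short by simp
  moreover have "int (length c) dvd b - a"
    using b'(1) xs(4) a cyc_eq_iff[OF c', of b a] by (simp add: mod_eq_dvd_iff)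
  ultimately have "b = a" using dvd_imp_le_int[of "b - a" "int (length c)"] by force
  then show ?thesis using that[of lo hi] b b'(2) by auto
qed

lemma cyc_segment_connected:
  assumes c: "is_cycle G c" and "i \<le> j"
  shows "(cyc c i, cyc c j) \<in> (adj_on G (cyc c ` {i..j}))\<^sup>*"
  using assms(2)
proof (induction rule: int_ge_induct)
  case (step j)
  have "{cyc c j, cyc c (j + 1)} \<in> edges G"
    using cycle_edges_cyc(2)[of c j] c by (cases "c = []") (auto simp: is_cycle_def)
  then have "(cyc c j, cyc c (j + 1)) \<in> adj_on G (cyc c ` {i..j + 1})"
    using step.hyps by (auto simp: adj_on_def)
  moreover have "(cyc c i, cyc c j) \<in> (adj_on G (cyc c ` {i..j + 1}))\<^sup>*"
    by (rule subsetD[OF rtrancl_mono[OF adj_on_mono] step.IH]) auto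
  ultimately show ?case by simp
qed simp

text \<open>
  The complement of an arc is again a segment, from \<open>hi + 1\<close> to \<open>lo + length c - 1\<close>. For
  \<open>hi < lo\<close> the arc is empty; the case \<open>lo = 1\<close>, \<open>hi = 0\<close> says that the cycle itself is connected.
\<close>

lemma arc_complement_connected:
  assumes c: "is_cycle G c"
    and y: "y \<in> set c - cyc c ` {lo..hi}" "y' \<in> set c - cyc c ` {lo..hi}"
  shows "(y, y') \<in> (adj_on G (set c - cyc c ` {lo..hi}))\<^sup>*"
proof -
  have c': "distinct c" "c \<noteq> []" using c by (auto simp: is_cycle_def)
  let ?k = "int (length c)"
  have pos: "\<exists>i. y = cyc c i \<and> hi < i \<and> i < lo + ?k" if y: "y \<in> set c - cyc c ` {lo..hi}" for y
  proof -
    from y obtain i where i: "y = cyc c i" "hi + 1 \<le> i" "i < hi + 1 + ?k"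
      using in_set_cycE[of y c "hi + 1"] by blast
    have "cyc c (i - ?k) = y" using cyc_add_length[of c "i - ?k"] i(1) by simp
    then have "i - ?k \<notin> {lo..hi}" using y by blast
    then show ?thesis using i by auto
  qed
  have avoid: "cyc c j \<in> set c - cyc c ` {lo..hi}" if j: "hi < j" "j < lo + ?k" for j
  proof -
    have "cyc c j \<notin> cyc c ` {lo..hi}"
    proof
      assume "cyc c j \<in> cyc c ` {lo..hi}"
      then obtain m where m: "m \<in> {lo..hi}" "cyc c j = cyc c m" by (rule imageE)
      then have "?k dvd j - m" by (simp add: cyc_eq_iff[OF c'] mod_eq_dvd_iff)
      then show False using dvd_imp_le_int[of "j - m" ?k] j m(1) by simp
    qed
    then show ?thesis using cyc_in_set[OF c'(2), of j] by simp
  qed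
  have conn: "(cyc c i, cyc c j) \<in> (adj_on G (set c - cyc c ` {lo..hi}))\<^sup>*"
    if "hi < i" "i \<le> j" "j < lo + ?k" for i j
    by (rule subsetD[OF rtrancl_mono[OF adj_on_mono] cyc_segment_connected[OF c that(2)]])
      (rule image_subsetI, use that avoid in simp)
  obtain i i' where "y = cyc c i" "hi < i" "i < lo + ?k" "y' = cyc c i'" "hi < i'" "i' < lo + ?k"
    using pos y by blast
  then show ?thesis using conn[of i i'] conn_sym[OF conn[of i' i]] by (cases "i \<le> i'") auto
qed

lemma conn_leaves:
  assumes "(a, b) \<in> (adj_on G A)\<^sup>*" "a \<in> D" "b \<notin> D"
  obtains u v where "u \<in> A \<inter> D" "v \<in> A - D" "{u, v} \<in> edges G"
proof -
  from assms have "\<exists>u v. u \<in> A \<inter> D \<and> v \<in> A - D \<and> {u, v} \<in> edges G"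
  proof (induction)
    case (step u v)
    then show ?case by (cases "u \<in> D") (auto simp: adj_on_def)
  qed simp
  then show ?thesis using that by blast
qed

section \<open>The large part of a geodesic cycle left by a small set\<close>

definition short_cycle_link :: "'a ugraph \<Rightarrow> 'a set \<Rightarrow> ('a \<times> 'a) set" where
  "short_cycle_link G X = {(u, v). u \<in> X \<and> v \<in> X \<and>
     (\<exists>z. is_cycle G z \<and> length z \<le> cycle_space_gen G \<and> u \<in> set z \<and> v \<in> set z)}"

definition cluster :: "'a ugraph \<Rightarrow> 'a set \<Rightarrow> 'a \<Rightarrow> 'a set" where
  "cluster G X x = {v. (x, v) \<in> (short_cycle_link G X)\<^sup>*}"

lemma short_cycle_link_sym: "(u, v) \<in> (short_cycle_link G X)\<^sup>* \<Longrightarrow> (v, u) \<in> (short_cycle_link G X)\<^sup>*"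
proof -
  assume "(u, v) \<in> (short_cycle_link G X)\<^sup>*"
  moreover have "sym (short_cycle_link G X)" by (auto simp: sym_def short_cycle_link_def)
  ultimately show ?thesis using symD[OF sym_rtrancl] by metis
qed

lemma cluster_self: "x \<in> cluster G X x"
  by (simp add: cluster_def)

lemma cluster_subset: "x \<in> X \<Longrightarrow> cluster G X x \<subseteq> X"
proof
  fix v assume "x \<in> X" "v \<in> cluster G X x"
  then have "(x, v) \<in> (short_cycle_link G X)\<^sup>*" by (simp add: cluster_def)
  then show "v \<in> X" using \<open>x \<in> X\<close> by induction (auto simp: short_cycle_link_def)
qed

lemma cluster_disjoint:
  assumes "cluster G X x \<noteq> cluster G X y"
  shows "cluster G X x \<inter> cluster G X y = {}"
proof (rule ccontr)
  assume "cluster G X x \<inter> cluster G X y \<noteq> {}"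
  then obtain v where v: "(x, v) \<in> (short_cycle_link G X)\<^sup>*" "(y, v) \<in> (short_cycle_link G X)\<^sup>*"
    by (auto simp: cluster_def)
  have xy: "(x, y) \<in> (short_cycle_link G X)\<^sup>*"
    by (rule rtrancl_trans[OF v(1) short_cycle_link_sym[OF v(2)]])
  have "cluster G X x = cluster G X y"
    unfolding cluster_def using rtrancl_trans[OF xy] rtrancl_trans[OF short_cycle_link_sym[OF xy]]
    by blast
  with assms show False by simp
qed

text \<open>
  A cluster is connected in the link relation, so that the relation joins any proper part of it to the
  rest.
\<close>

lemma cluster_link:
  assumes T: "T \<subseteq> cluster G X x" "T \<noteq> {}" "T \<noteq> cluster G X x"
  shows "\<exists>u\<in>T. \<exists>v\<in>cluster G X x - T. (u, v) \<in> short_cycle_link G X"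
proof (rule ccontr)
  assume no: "\<not> ?thesis"
  obtain a b where ab: "a \<in> T" "b \<in> cluster G X x - T" using T by blast
  then have xa: "(x, a) \<in> (short_cycle_link G X)\<^sup>*" "(x, b) \<in> (short_cycle_link G X)\<^sup>*"
    using T(1) by (auto simp: cluster_def)
  have "(a, b) \<in> (short_cycle_link G X)\<^sup>*"
    by (rule rtrancl_trans[OF short_cycle_link_sym[OF xa(1)] xa(2)])
  then have "b \<in> T"
  proof induction
    case base
    show ?case by (rule ab(1))
  next
    case (step u v)
    have "(x, v) \<in> (short_cycle_link G X)\<^sup>*"
      by (rule rtrancl_trans[OF xa(1) rtrancl_into_rtrancl[OF step.hyps]])
    then have "v \<in> cluster G X x" by (simp add: cluster_def)
    then show ?case using step.IH step.hyps(2) no by blast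
  qed
  then show False using ab(2) by blast
qed

lemma cluster_in_arc:
  assumes G: "simple_graph G" and c: "geodesic_cycle G c"
    and X: "finite X" "(card X - 1) * cycle_space_gen G < length c"
    and x: "x \<in> X \<inter> set c"
  shows "\<exists>lo hi. 2 * card (cyc c ` {lo..hi}) \<le> (card (cluster G X x) - 1) * cycle_space_gen G + 2 \<and>
    cluster G X x \<inter> set c \<subseteq> cyc c ` {lo..hi}"
proof -
  let ?Q = "cluster G X x" and ?l = "cycle_space_gen G"
  have QX: "?Q \<subseteq> X" using x by (intro cluster_subset) simp
  then have "finite ?Q" using X(1) finite_subset by blast
  have "\<exists>u\<in>T. \<exists>v\<in>?Q - T. \<exists>z. is_cycle G z \<and> length z \<le> ?l \<and> u \<in> set z \<and> v \<in> set z"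
    if "T \<subseteq> ?Q" "T \<noteq> {}" "T \<noteq> ?Q" for T
    using cluster_link[OF that] unfolding short_cycle_link_def by blast
  from closed_walk_through_cluster[OF \<open>finite ?Q\<close> cluster_self this]
  obtain xs where xs: "path_edges xs \<subseteq> edges G" "xs \<noteq> []" "hd xs = x" "last xs = x" "?Q \<subseteq> set xs"
    "length xs \<le> (card ?Q - 1) * ?l + 1" by blast
  have "(card ?Q - 1) * ?l \<le> (card X - 1) * ?l"
    using card_mono[OF X(1) QX] by (intro mult_right_mono) auto
  then have "length xs \<le> length c" using xs(6) X(2) by linarith
  then obtain lo hi where a: "lo \<le> hi" "2 * (hi - lo) < int (length xs)"
    "set xs \<inter> set c \<subseteq> cyc c ` {lo..hi}"
    using closed_walk_in_arc[OF c G xs(1,2)] x xs(3,4) by auto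
  have "card (cyc c ` {lo..hi}) \<le> nat (hi - lo + 1)"
    using card_image_le[of "{lo..hi}" "cyc c"] by (simp add: add.commute)
  then have "int (card (cyc c ` {lo..hi})) \<le> hi - lo + 1" using a(1) by simp
  then have "2 * card (cyc c ` {lo..hi}) \<le> length xs + 1" using a(2) by simp
  then show ?thesis using xs(5,6) a(3) by (intro exI[of _ lo] exI[of _ hi]) auto
qed

text \<open>
  The clusters are disjoint, so this adds up to at most \<open>l * card X\<close> minus \<open>l - 2\<close> for every cluster.
  One cluster is therefore the worst case, provided that \<open>2 \<le> l\<close>.
\<close>

lemma clusters_total:
  assumes X: "finite X" "\<Q> = cluster G X ` S" "S \<subseteq> X" "S \<noteq> {}" and l: "2 \<le> l"
  shows "(\<Sum>Q\<in>\<Q>. (card Q - 1) * l + 2) \<le> (card X - 1) * l + (2::nat)"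
proof -
  have fin: "finite S" using X finite_subset by blast
  have Q: "finite Q" "1 \<le> card Q" "Q \<subseteq> X" if "Q \<in> \<Q>" for Q
  proof -
    obtain x where x: "x \<in> S" "Q = cluster G X x" using \<open>Q \<in> \<Q>\<close> X(2) by blast
    then have "x \<in> X" using X(3) by blast
    then show "Q \<subseteq> X" unfolding x(2) by (rule cluster_subset)
    then show "finite Q" using X(1) finite_subset by blast
    then show "1 \<le> card Q" using x cluster_self[of x G X] by (auto simp: Suc_le_eq card_gt_0_iff)
  qed
  have "(\<Sum>Q\<in>\<Q>. card Q) = card (\<Union>\<Q>)"
    using Q(1) cluster_disjoint[of G X] X(2)
    by (subst card_Union_disjoint) (auto simp: pairwise_def disjnt_def)
  also have "\<dots> \<le> card X" using Q(3) X(1) by (intro card_mono) auto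
  finally have total: "(\<Sum>Q\<in>\<Q>. card Q) \<le> card X" .
  have m: "1 \<le> card \<Q>" using X(2,4) fin by (simp add: Suc_le_eq card_gt_0_iff)
  have "1 \<le> card X" using X(1,3,4) by (auto simp: Suc_le_eq card_gt_0_iff)
  have "(\<Sum>Q\<in>\<Q>. int ((card Q - 1) * l + 2)) = (\<Sum>Q\<in>\<Q>. int l * int (card Q) - (int l - 2))"
    using Q(2) by (intro sum.cong) (auto simp: algebra_simps)
  also have "\<dots> = int l * (\<Sum>Q\<in>\<Q>. int (card Q)) - int (card \<Q>) * (int l - 2)"
    by (simp add: sum_subtractf sum_distrib_left)
  also have "\<dots> \<le> int l * int (card X) - 1 * (int l - 2)"
  proof (intro diff_mono mult_left_mono mult_right_mono)
    show "(\<Sum>Q\<in>\<Q>. int (card Q)) \<le> int (card X)"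
      using total by (simp flip: of_nat_sum)
  qed (use m l in auto)
  also have "\<dots> = int ((card X - 1) * l + 2)"
    using \<open>1 \<le> card X\<close> by (simp add: algebra_simps)
  finally show ?thesis by (simp only: of_nat_le_iff flip: of_nat_sum)
qed

lemma attachments_in_cluster:
  assumes link: "\<And>T. T \<subseteq> N \<Longrightarrow> T \<noteq> {} \<Longrightarrow> T \<noteq> N \<Longrightarrow> \<exists>u\<in>T. \<exists>v\<in>N - T. (u, v) \<in> short_cycle_link G X"
    and x: "x \<in> N"
  shows "N \<subseteq> cluster G X x"
proof (rule ccontr)
  assume "\<not> ?thesis"
  then obtain u v where uv: "u \<in> N \<inter> cluster G X x" "v \<in> N - (N \<inter> cluster G X x)"
    "(u, v) \<in> short_cycle_link G X"
    using link[of "N \<inter> cluster G X x"] x cluster_self[of x G X] by blast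
  then have "v \<in> cluster G X x"
    unfolding cluster_def by (blast intro: rtrancl_into_rtrancl)
  with uv show False by blast
qed

text \<open>
  To see that \<open>X\<close> does not separate \<open>Y\<close>, suppose that \<open>y'\<close> is not in the component \<open>D\<close> of \<open>y\<close> in \<open>G - X\<close>,
  and let \<open>D'\<close> be the component of \<open>y'\<close> in \<open>G - D\<close>. All neighbours of \<open>D'\<close> outside itself are in
  \<open>D\<close>, and the set \<open>N\<close> of vertices of \<open>D'\<close> that have neighbours in \<open>D\<close> lies in \<open>X\<close>. However
  \<open>N\<close> is split in two, a short cycle meets both classes, so all of \<open>N\<close> is in one cluster. Yet the cycle joins \<open>y'\<close> to \<open>y\<close>
  avoiding the arc of that cluster, and must pass through \<open>N\<close> on the way.
\<close>

lemma large_side: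
  assumes G: "simple_graph G" and c: "geodesic_cycle G c"
    and X: "finite X" "(card X - 1) * cycle_space_gen G < length c"
  obtains Y where "Y \<subseteq> set c - X" "length c < 2 * card Y + 2"
    "\<And>y y'. y \<in> Y \<Longrightarrow> y' \<in> Y \<Longrightarrow> (y, y') \<in> (adj_on G (verts G - X))\<^sup>*"
proof -
  let ?l = "cycle_space_gen G"
  have cyc: "is_cycle G c" and c': "distinct c" "set c \<subseteq> verts G"
    using c by (auto simp: geodesic_cycle_def is_cycle_def)
  define \<Q> where "\<Q> = cluster G X ` (X \<inter> set c)"
  have "\<forall>Q\<in>\<Q>. \<exists>lo hi. 2 * card (cyc c ` {lo..hi}) \<le> (card Q - 1) * ?l + 2 \<and>
      Q \<inter> set c \<subseteq> cyc c ` {lo..hi}"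
    using cluster_in_arc[OF G c X] by (auto simp: \<Q>_def)
  then obtain lo hi where
    arc: "\<And>Q. Q \<in> \<Q> \<Longrightarrow> 2 * card (cyc c ` {lo Q..hi Q}) \<le> (card Q - 1) * ?l + 2"
      "\<And>Q. Q \<in> \<Q> \<Longrightarrow> Q \<inter> set c \<subseteq> cyc c ` {lo Q..hi Q}"
    by metis
  define Y where "Y = set c - (\<Union>Q\<in>\<Q>. cyc c ` {lo Q..hi Q})"
  have "finite \<Q>" by (simp add: \<Q>_def)
  have "2 * card (\<Union>Q\<in>\<Q>. cyc c ` {lo Q..hi Q}) \<le> (\<Sum>Q\<in>\<Q>. 2 * card (cyc c ` {lo Q..hi Q}))"
    using card_UN_le[OF \<open>finite \<Q>\<close>] by (simp flip: sum_distrib_left)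
  also have "\<dots> \<le> (\<Sum>Q\<in>\<Q>. (card Q - 1) * ?l + 2)" using arc(1) by (rule sum_mono)
  also have "\<dots> < length c + 2"
  proof (cases "X \<inter> set c = {}")
    case False
    have "2 \<le> ?l" using cycle_space_gen_ge_3[OF G cyc] by simp
    from clusters_total[OF X(1) \<Q>_def _ False this] X(2) show ?thesis by simp
  qed (simp add: \<Q>_def)
  finally have "2 * card (\<Union>Q\<in>\<Q>. cyc c ` {lo Q..hi Q}) < length c + 2" .
  moreover have "length c - card (\<Union>Q\<in>\<Q>. cyc c ` {lo Q..hi Q}) \<le> card Y"
    using diff_card_le_card_Diff[of "\<Union>Q\<in>\<Q>. cyc c ` {lo Q..hi Q}" "set c"] \<open>finite \<Q>\<close>
    by (simp add: Y_def distinct_card[OF c'(1)])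
  ultimately have large: "length c < 2 * card Y + 2" by linarith
  have YX: "Y \<subseteq> set c - X"
  proof
    fix y assume y: "y \<in> Y"
    have "y \<notin> X"
    proof
      assume "y \<in> X"
      then have "cluster G X y \<in> \<Q>" using y by (auto simp: \<Q>_def Y_def)
      moreover from this have "y \<in> cyc c ` {lo (cluster G X y)..hi (cluster G X y)}"
        using arc(2)[of "cluster G X y"] cluster_self[of y G X] y by (auto simp: Y_def)
      ultimately show False using y by (auto simp: Y_def)
    qed
    then show "y \<in> set c - X" using y by (auto simp: Y_def)
  qed
  have "(y, y') \<in> (adj_on G (verts G - X))\<^sup>*" if y: "y \<in> Y" "y' \<in> Y" for y y'
  proof (rule ccontr)
    assume sep: "(y, y') \<notin> (adj_on G (verts G - X))\<^sup>*"
    define D where "D = component G (verts G - X) y"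
    define D' where "D' = component G (verts G - D) y'"
    have yV: "y \<in> verts G - X" "y' \<in> verts G - X" using y YX c'(2) by auto
    have y'D: "y' \<notin> D" using sep by (simp add: D_def component_def)
    then have y'D': "y' \<in> verts G - D" using yV by blast
    have DV: "D \<subseteq> verts G - X" unfolding D_def using component_subset[OF yV(1)] .
    have D'V: "D' \<subseteq> verts G - D" unfolding D'_def using component_subset[OF y'D'] .
    define N where "N = {u \<in> D'. \<exists>v \<in> D. {u, v} \<in> edges G}"
    have out: "v \<in> D" if "u \<in> D'" "{u, v} \<in> edges G" "v \<notin> D'" for u v
    proof (rule ccontr)
      assume "v \<notin> D"
      then have "v \<in> verts G - D" using that(2) G by (auto simp: simple_graph_def)
      then show False using component_neighbour[OF y'D', of u G v] that unfolding D'_def by blast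
    qed
    have NX: "N \<subseteq> X"
    proof
      fix u assume "u \<in> N"
      then obtain v where v: "u \<in> D'" "v \<in> D" "{v, u} \<in> edges G" by (auto simp: N_def insert_commute)
      show "u \<in> X"
      proof (rule ccontr)
        assume "u \<notin> X"
        then have "u \<in> verts G - X" using v D'V by blast
        then have "u \<in> D" using component_neighbour[OF yV(1), of v G u] v unfolding D_def by blast
        then show False using v D'V by blast
      qed
    qed
    have link: "\<exists>u\<in>T. \<exists>v\<in>N - T. (u, v) \<in> short_cycle_link G X"
      if T: "T \<subseteq> N" "T \<noteq> {}" "T \<noteq> N" for T
    proof -
      have "\<forall>u\<in>D. \<forall>v\<in>D. (u, v) \<in> (adj_on G D)\<^sup>*"
        unfolding D_def by (intro ballI component_connected)
      moreover have "\<forall>u\<in>D'. \<forall>v\<in>D'. (u, v) \<in> (adj_on G D')\<^sup>*"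
        unfolding D'_def by (intro ballI component_connected)
      moreover have "D \<subseteq> verts G" "D' \<subseteq> verts G" "D \<inter> D' = {}" using DV D'V by auto
      moreover have "\<forall>u\<in>D'. \<forall>v. {u, v} \<in> edges G \<longrightarrow> v \<in> D \<union> D'" using out by blast
      ultimately obtain z u v where "is_cycle G z" "length z \<le> ?l" "u \<in> set z" "v \<in> set z"
        "u \<in> T" "v \<in> N - T"
        using cycle_through_attachments[OF G, of D D' N T] N_def T by blast
      then show ?thesis using T(1) NX unfolding short_cycle_link_def by blast
    qed
    have meets: "\<exists>u. u \<in> A \<inter> N" if conn: "(y', y) \<in> (adj_on G A)\<^sup>*" for A
    proof -
      have "y' \<in> D'" "y \<notin> D'"
        using component_self[of y'] component_self[of y] D'V unfolding D_def D'_def by blast+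
      then obtain u v where "u \<in> A \<inter> D'" "v \<in> A - D'" "{u, v} \<in> edges G"
        using conn_leaves[OF conn] by blast
      then show ?thesis using out unfolding N_def by blast
    qed
    have yc: "y \<in> set c" "y' \<in> set c" using y by (auto simp: Y_def)
    \<comment> \<open>The whole cycle gives a first vertex of \<open>N\<close>, and with it the cluster whose arc is to be avoided.\<close>
    then obtain x where x: "x \<in> set c \<inter> N"
      using meets[of "set c"] arc_complement_connected[OF cyc, of y' 1 0 y] by auto
    define Q where "Q = cluster G X x"
    have "N \<subseteq> Q" unfolding Q_def using attachments_in_cluster[OF link] x by blast
    have "Q \<in> \<Q>" using x NX by (auto simp: Q_def \<Q>_def)
    then have "(y', y) \<in> (adj_on G (set c - cyc c ` {lo Q..hi Q}))\<^sup>*"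
      using y by (intro arc_complement_connected[OF cyc]) (auto simp: Y_def)
    from meets[OF this] \<open>N \<subseteq> Q\<close> arc(2)[OF \<open>Q \<in> \<Q>\<close>] show False by blast
  qed
  then show ?thesis using that YX large by blast
qed

text \<open>
  Otherwise, going around the cycle in the positive direction, the vertex following a last vertex of \<open>Y\<close>
  and the vertex following a last vertex of \<open>Y'\<close> are two different vertices outside \<open>Y \<union> Y'\<close>.
  This leaves at most \<open>length c - 2\<close> vertices for the two sets together, which is too few.
\<close>

lemma large_subsets_touch:
  assumes c: "is_cycle G c"
    and Y: "Y \<subseteq> set c" "length c < 2 * card Y + 2"
    and Y': "Y' \<subseteq> set c" "length c < 2 * card Y' + 2"
  obtains y y' where "y \<in> Y" "y' \<in> Y'" "y = y' \<or> {y, y'} \<in> edges G"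
proof (rule ccontr)
  assume neg: "\<not> thesis"
  have c': "distinct c" "c \<noteq> []" "3 \<le> length c" using c by (auto simp: is_cycle_def)
  have fin: "finite Y" "finite Y'" using Y Y' finite_subset by auto
  have ne: "Y \<noteq> {}" "Y' \<noteq> {}" using Y(2) Y'(2) c'(3) by auto
  have disj: "Y \<inter> Y' = {}" using neg that by blast
  have edge: "{cyc c i, cyc c (i + 1)} \<in> edges G" for i
    using cycle_edges_cyc(2)[OF c'(2), of i] c by (auto simp: is_cycle_def)
  have boundary: "\<exists>i. cyc c i \<in> Z \<and> cyc c (i + 1) \<notin> Z"
    if Z: "Z \<subseteq> set c" "Z \<noteq> {}" "v \<in> set c - Z" for Z v
  proof (rule ccontr)
    assume no: "\<not> ?thesis"
    obtain i where i: "cyc c i \<in> Z" using Z(1,2) in_set_cycE by (metis all_not_in_conv subsetD)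
    have "cyc c j \<in> Z" if "i \<le> j" for j
      using that by (induction rule: int_ge_induct) (use i no in auto)
    then show False using in_set_cycE[of v c i] Z(3) by blast
  qed
  obtain i where i: "cyc c i \<in> Y" "cyc c (i + 1) \<notin> Y"
    using boundary[OF Y(1) ne(1)] Y'(1) ne(2) disj by blast
  obtain j where j: "cyc c j \<in> Y'" "cyc c (j + 1) \<notin> Y'"
    using boundary[OF Y'(1) ne(2)] Y(1) ne(1) disj by blast
  have i': "cyc c (i + 1) \<notin> Y'" using neg that i(1) edge by blast
  have j': "cyc c (j + 1) \<notin> Y" using neg that[of "cyc c (j + 1)" "cyc c j"] j(1) edge[of j]
    by (auto simp: insert_commute)
  have "cyc c (i + 1) \<noteq> cyc c (j + 1)"
  proof
    assume "cyc c (i + 1) = cyc c (j + 1)"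
    then have "cyc c i = cyc c j" by (simp add: cyc_eq_iff[OF c'(1,2)] mod_eq_dvd_iff)
    then show False using i(1) j(1) disj by auto
  qed
  then have "card (Y \<union> Y' \<union> {cyc c (i + 1), cyc c (j + 1)}) = card Y + card Y' + 2"
    using i i' j j' disj fin by (subst card_Un_disjoint) (auto simp: card_Un_disjoint)
  moreover have "card (Y \<union> Y' \<union> {cyc c (i + 1), cyc c (j + 1)}) \<le> card (set c)"
    using Y(1) Y'(1) cyc_in_set[OF c'(2)] by (intro card_mono) auto
  ultimately show False using Y(2) Y'(2) distinct_card[OF c'(1)] by linarith
qed

section \<open>Pointing towards large sides in a tree\<close>

lemma tree_neighbours_separated:
  assumes T: "is_tree T" and ab: "{x, a} \<in> edges T" "{x, b} \<in> edges T" "a \<noteq> b"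
  shows "(a, b) \<notin> (adj_on T (verts T - {x}))\<^sup>*"
proof
  assume conn: "(a, b) \<in> (adj_on T (verts T - {x}))\<^sup>*"
  have V: "x \<in> verts T" "a \<in> verts T - {x}"
    using T ab(1) by (auto simp: is_tree_def simple_graph_def card_insert_if)
  obtain p where p: "p \<noteq> []" "distinct p" "hd p = a" "last p = b" "set p \<subseteq> verts T - {x}"
    "path_edges p \<subseteq> edges T" using conn_to_path[OF conn V(2)] by blast
  have "2 \<le> length p" using p ab(3) by (cases p; cases "tl p") auto
  moreover have "path_edges (x # p) = insert {x, a} (path_edges p)"
    using p(1,3) by (cases p) auto
  ultimately have "is_cycle T (x # p)"
    using p ab V(1) by (auto simp: is_cycle_def cycle_edges_def insert_commute)
  then show False using T by (auto simp: is_tree_def)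
qed

text \<open>
  Let \<open>a\<close> be the second vertex of a path from \<open>t'\<close> to \<open>s\<close> avoiding \<open>t\<close>. Via \<open>s\<close>, the distinct neighbours
  \<open>a\<close> and \<open>t\<close> of \<open>t'\<close> would be connected in \<open>T - t'\<close>.
\<close>

lemma tree_sides_of_edge_disjoint:
  assumes T: "is_tree T" and e: "{t, t'} \<in> edges T"
    and s: "(t', s) \<in> (adj_on T (verts T - {t}))\<^sup>*" "(t, s) \<in> (adj_on T (verts T - {t'}))\<^sup>*"
  shows False
proof -
  have V: "t \<in> verts T" "t' \<in> verts T" "t \<noteq> t'"
    using T e by (auto simp: is_tree_def simple_graph_def)
  then have V': "t' \<in> verts T - {t}" "t \<in> verts T - {t'}" by auto
  obtain p where p: "p \<noteq> []" "distinct p" "hd p = t'" "last p = s" "set p \<subseteq> verts T - {t}"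
    "path_edges p \<subseteq> edges T" using conn_to_path[OF s(1) V'(1)] by blast
  have "s \<noteq> t'" using component_subset[OF V'(2), of T] s(2) by (auto simp: component_def)
  then obtain a q where q: "p = t' # a # q"
    using p(1,3,4) by (cases p; cases "tl p") auto
  have "(hd (a # q), last (a # q)) \<in> (adj_on T (verts T - {t'}))\<^sup>*"
    using p q by (intro path_to_walk) auto
  then have "(a, s) \<in> (adj_on T (verts T - {t'}))\<^sup>*" using p(4) q by simp
  then have "(a, t) \<in> (adj_on T (verts T - {t'}))\<^sup>*" using conn_sym[OF s(2)] by simp
  moreover have "a \<noteq> t" "{t', a} \<in> edges T" using p q by auto
  ultimately show False using tree_neighbours_separated[OF T, of t' a t] e by (simp add: insert_commute)
qed

text \<open>
  Every \<open>S t\<close> lies in the branch of \<open>T - t\<close> at some neighbour \<open>nx t\<close>. Choose \<open>t\<close> with this branch as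
  small as possible and let \<open>t'\<close> be \<open>nx t\<close>. If \<open>nx t'\<close> is not \<open>t\<close>, then the branch at \<open>t'\<close> is properly
  contained in the one at \<open>t\<close>, as it lacks \<open>t'\<close>. If \<open>nx t'\<close> is \<open>t\<close>, then \<open>S t\<close> and \<open>S t'\<close> lie on
  different sides of an edge of the tree and cannot meet.
\<close>

lemma tree_no_escaping_family:
  assumes T: "is_tree T"
    and S: "\<And>t. t \<in> verts T \<Longrightarrow> S t \<subseteq> verts T - {t}"
    and conn: "\<And>t s s'. t \<in> verts T \<Longrightarrow> s \<in> S t \<Longrightarrow> s' \<in> S t \<Longrightarrow>
      (s, s') \<in> (adj_on T (verts T - {t}))\<^sup>*"
    and meet: "\<And>t t'. t \<in> verts T \<Longrightarrow> t' \<in> verts T \<Longrightarrow> S t \<inter> S t' \<noteq> {}"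
  shows False
proof -
  have TG: "simple_graph T" "verts T \<noteq> {}" "finite (verts T)"
    using T by (auto simp: is_tree_def simple_graph_def)
  let ?K = "\<lambda>t t'. component T (verts T - {t}) t'"
  have "\<exists>t'. {t, t'} \<in> edges T \<and> S t \<subseteq> ?K t t'" if t: "t \<in> verts T" for t
  proof -
    obtain s where s: "s \<in> S t" using meet[OF t t] by blast
    then have sV: "s \<in> verts T" "s \<noteq> t" using S[OF t] by auto
    then obtain p where p: "path_between T t s p"
      using T t unfolding is_tree_def by blast
    then obtain t' q where q: "p = t # t' # q"
      using sV(2) by (cases p; cases "tl p") (auto simp: path_between_def)
    have "(hd (t' # q), last (t' # q)) \<in> (adj_on T (verts T - {t}))\<^sup>*"
      using p q by (intro path_to_walk) (auto simp: path_between_def)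
    then have "(t', s) \<in> (adj_on T (verts T - {t}))\<^sup>*"
      using p q by (simp add: path_between_def)
    then have "S t \<subseteq> ?K t t'"
      using conn[OF t s] by (auto simp: component_def intro: rtrancl_trans)
    moreover have "{t, t'} \<in> edges T" using p q by (auto simp: path_between_def)
    ultimately show ?thesis by blast
  qed
  then obtain nx where nx: "\<And>t. t \<in> verts T \<Longrightarrow> {t, nx t} \<in> edges T"
    "\<And>t. t \<in> verts T \<Longrightarrow> S t \<subseteq> ?K t (nx t)" by metis
  obtain t where t: "t \<in> verts T"
    and least: "\<And>s. s \<in> verts T \<Longrightarrow> card (?K t (nx t)) \<le> card (?K s (nx s))"
    using ex_has_least_nat[of "\<lambda>t. t \<in> verts T" _ "\<lambda>t. card (?K t (nx t))"] TG(2) by blast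
  define t' where "t' = nx t"
  define t'' where "t'' = nx t'"
  have e: "{t, t'} \<in> edges T" using nx(1)[OF t] by (simp add: t'_def)
  then have t': "t' \<in> verts T" "t \<noteq> t'" using TG(1) by (auto simp: simple_graph_def)
  have e': "{t', t''} \<in> edges T" using nx(1)[OF t'(1)] by (simp add: t''_def)
  then have t'': "t'' \<in> verts T" "t' \<noteq> t''" using TG(1) by (auto simp: simple_graph_def)
  show False
  proof (cases "t'' = t")
    case True
    obtain s where "s \<in> S t" "s \<in> S t'" using meet[OF t t'(1)] by blast
    then have "s \<in> ?K t t'" "s \<in> ?K t' t"
      using nx(2)[OF t] nx(2)[OF t'(1)] True unfolding t'_def t''_def by auto
    then show False using tree_sides_of_edge_disjoint[OF T e] by (simp add: component_def)
  next
    case False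
    have "v \<in> ?K t t'" if "v \<in> ?K t' t''" for v
    proof -
      from that have "(t'', v) \<in> (adj_on T (verts T - {t'}))\<^sup>*" by (simp add: component_def)
      then have "(t', v) \<in> (adj_on T (verts T - {t}))\<^sup>*"
      proof induction
        case base
        have "(t', t'') \<in> adj_on T (verts T - {t})"
          using e' t' t'' False by (auto simp: adj_on_def)
        then show ?case by simp
      next
        case (step u v)
        have "(t'', v) \<in> (adj_on T (verts T - {t'}))\<^sup>*" using step.hyps by simp
        then have "u \<noteq> t" "v \<noteq> t"
          using tree_neighbours_separated[OF T e', of t] step.hyps(1) e False
          by (auto simp: insert_commute)
        then have "(u, v) \<in> adj_on T (verts T - {t})" using step.hyps(2) by (auto simp: adj_on_def)
        then show ?case using step.IH by simp
      qed
      then show ?thesis by (simp add: component_def)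
    qed
    moreover have "t' \<in> ?K t t'" by (rule component_self)
    moreover have "t' \<notin> ?K t' t''"
      using component_subset[of t'' "verts T - {t'}" T] t'' by blast
    ultimately have "?K t' t'' \<subset> ?K t t'" by blast
    moreover have "finite (?K t t')"
      by (rule finite_subset[OF component_subset]) (use t' TG(3) in auto)
    ultimately have "card (?K t' t'') < card (?K t t')" by (rule psubset_card_mono[rotated])
    then show False using least[OF t'(1)] by (simp add: t'_def t''_def)
  qed
qed

section \<open>Tree-width\<close>

text \<open>
  The nodes whose parts contain a given vertex outside \<open>B t\<close> are joined by paths avoiding \<open>t\<close>, and the
  ends of an edge share a part; so the nodes of a connected set avoiding \<open>B t\<close> stay in one branch
  at \<open>t\<close>.
\<close>

lemma bags_of_connected_set:
  assumes TD: "tree_decomposition G T B" and t: "t \<in> verts T"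
    and y: "(y, y') \<in> (adj_on G (verts G - B t))\<^sup>*" "y \<notin> B t"
    and s: "s \<in> verts T" "y \<in> B s" and s': "s' \<in> verts T" "y' \<in> B s'"
  shows "(s, s') \<in> (adj_on T (verts T - {t}))\<^sup>*"
proof -
  have T: "is_tree T" using TD by (simp add: tree_decomposition_def)
  have same: "(r, r') \<in> (adj_on T (verts T - {t}))\<^sup>*"
    if r: "r \<in> verts T" "r' \<in> verts T" "v \<in> B r" "v \<in> B r'" "v \<notin> B t" for v r r'
  proof -
    obtain p where p: "path_between T r r' p"
      using T r(1,2) unfolding is_tree_def by blast
    then have "B r \<inter> B r' \<subseteq> B u" if "u \<in> set p" for u
      using TD that unfolding tree_decomposition_def by blast
    then have "t \<notin> set p" using r by blast
    then have "(hd p, last p) \<in> (adj_on T (verts T - {t}))\<^sup>*"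
      using p by (intro path_to_walk) (auto simp: path_between_def)
    then show ?thesis using p by (simp add: path_between_def)
  qed
  from y(1) show ?thesis using s'
  proof (induction arbitrary: s')
    case base
    then show ?case using same[OF s(1)] s(2) y(2) by blast
  next
    case (step u v)
    have uv: "{u, v} \<in> edges G" "v \<notin> B t" using step.hyps(2) by (auto simp: adj_on_def)
    then obtain r where r: "r \<in> verts T" "u \<in> B r" "v \<in> B r"
      using TD by (auto simp: tree_decomposition_def)
    have "(s, r) \<in> (adj_on T (verts T - {t}))\<^sup>*" using step.IH r by blast
    also have "(r, s') \<in> (adj_on T (verts T - {t}))\<^sup>*" using same[OF r(1)] r step.prems uv by blast
    finally show ?case .
  qed
qed

text \<open>
  Otherwise every part \<open>B t\<close> has a large side in the sense of \<open>large_side\<close>, and the sets \<open>S t\<close> of nodes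
  whose parts meet it are connected off \<open>t\<close> and meet pairwise, which a tree does not admit.
\<close>

lemma geodesic_cycle_length_le:
  assumes G: "simple_graph G" and c: "geodesic_cycle G c"
    and TD: "tree_decomposition G T B"
    and n: "\<And>t. t \<in> verts T \<Longrightarrow> card (B t) \<le> n"
  shows "length c \<le> (n - 1) * cycle_space_gen G"
proof (rule ccontr)
  assume "\<not> ?thesis"
  then have small: "(n - 1) * cycle_space_gen G < length c" by simp
  have T: "is_tree T" and cov: "(\<Union>t\<in>verts T. B t) = verts G"
    and edge_bag: "\<forall>e\<in>edges G. \<exists>t\<in>verts T. e \<subseteq> B t"
    using TD by (auto simp: tree_decomposition_def)
  have cyc: "is_cycle G c" and cV: "set c \<subseteq> verts G"
    using c by (auto simp: geodesic_cycle_def is_cycle_def)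
  have "\<exists>Y. Y \<subseteq> set c - B t \<and> length c < 2 * card Y + 2 \<and>
      (\<forall>y\<in>Y. \<forall>y'\<in>Y. (y, y') \<in> (adj_on G (verts G - B t))\<^sup>*)" if t: "t \<in> verts T" for t
  proof -
    have "finite (B t)" using G cov t by (auto simp: simple_graph_def intro: finite_subset)
    moreover have "(card (B t) - 1) * cycle_space_gen G \<le> (n - 1) * cycle_space_gen G"
      using n[OF t] by (intro mult_right_mono) auto
    ultimately show ?thesis using large_side[OF G c, of "B t"] small by (metis le_less_trans)
  qed
  then obtain Y where Y: "\<And>t. t \<in> verts T \<Longrightarrow> Y t \<subseteq> set c - B t"
    "\<And>t. t \<in> verts T \<Longrightarrow> length c < 2 * card (Y t) + 2"
    "\<And>t y y'. t \<in> verts T \<Longrightarrow> y \<in> Y t \<Longrightarrow> y' \<in> Y t \<Longrightarrow> (y, y') \<in> (adj_on G (verts G - B t))\<^sup>*"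
    by metis
  define S where "S = (\<lambda>t. {s \<in> verts T. B s \<inter> Y t \<noteq> {}})"
  show False
  proof (rule tree_no_escaping_family[OF T, of S])
    show "S t \<subseteq> verts T - {t}" if "t \<in> verts T" for t
      using Y(1)[OF that] by (auto simp: S_def)
    show "(s, s') \<in> (adj_on T (verts T - {t}))\<^sup>*" if t: "t \<in> verts T" and s: "s \<in> S t" "s' \<in> S t" for t s s'
    proof -
      obtain y y' where y: "y \<in> Y t" "y \<in> B s" "y' \<in> Y t" "y' \<in> B s'" "s \<in> verts T" "s' \<in> verts T"
        using s by (auto simp: S_def)
      then show ?thesis using bags_of_connected_set[OF TD t Y(3)[OF t y(1,3)]] Y(1)[OF t] by blast
    qed
    show "S t \<inter> S t' \<noteq> {}" if t: "t \<in> verts T" "t' \<in> verts T" for t t'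
    proof -
      have "Y t \<subseteq> set c" "Y t' \<subseteq> set c" using Y(1) t by blast+
      then obtain y y' where y: "y \<in> Y t" "y' \<in> Y t'" "y = y' \<or> {y, y'} \<in> edges G"
        using large_subsets_touch[OF cyc _ Y(2)[OF t(1)] _ Y(2)[OF t(2)]] by blast
      have "\<exists>s\<in>verts T. y \<in> B s \<and> y' \<in> B s"
      proof (cases "y = y'")
        case True
        have "y \<in> verts G" using y(1) Y(1)[OF t(1)] cV by blast
        then show ?thesis using True cov by blast
      next
        case False
        then have "{y, y'} \<in> edges G" using y(3) by blast
        from bspec[OF edge_bag this] obtain s where "s \<in> verts T" "{y, y'} \<subseteq> B s" by (rule bexE)
        then show ?thesis by auto
      qed
      then show ?thesis using y by (auto simp: S_def)
    qed
  qed
qed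

text \<open>
  The minimum defining tree-width is attained, since at least the decomposition into a single part exists.
\<close>

lemma optimal_tree_decomposition:
  assumes "simple_graph G"
  obtains T :: "nat ugraph" and B where "tree_decomposition G T B"
    "tree_width G = int (max_part_size T B) - 1"
proof -
  let ?P = "\<lambda>n. \<exists>(T :: nat ugraph) B. tree_decomposition G T B \<and> max_part_size T B = n"
  let ?T = "\<lparr>verts = {0 :: nat}, edges = {}\<rparr>"
  have "path_between ?T 0 0 [0]" by (simp add: path_between_def)
  then have "is_tree ?T"
    by (auto simp: is_tree_def simple_graph_def is_cycle_def cycle_edges_def)
  moreover have "t = 0" if "path_between ?T r s p" "t \<in> set p" for r s p t
    using that by (auto simp: path_between_def)
  ultimately have "tree_decomposition G ?T (\<lambda>_. verts G)"
    using assms by (auto simp: tree_decomposition_def simple_graph_def)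
  then have "\<exists>n. ?P n"
    by (intro exI[of _ "max_part_size ?T (\<lambda>_. verts G)"] exI[of _ ?T]
        exI[of _ "\<lambda>_. verts G"] conjI refl)
  then have "?P (LEAST n. ?P n)" by (rule LeastI_ex)
  then obtain T :: "nat ugraph" and B where "tree_decomposition G T B"
    "max_part_size T B = (LEAST n. ?P n)" by (elim exE conjE)
  then show ?thesis using that[of T B] by (simp add: tree_width_def)
qed

theorem corollary3:
  fixes G :: "'a ugraph" and c :: "'a list" and k :: nat
  assumes "simple_graph G"
    and "geodesic_cycle G c" and "length c = k"
  shows "real_of_int (tree_width G) \<ge> real k / real (cycle_space_gen G)"
proof -
  let ?l = "cycle_space_gen G"
  obtain T :: "nat ugraph" and B where TD: "tree_decomposition G T B"
    and tw: "tree_width G = int (max_part_size T B) - 1"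
    using optimal_tree_decomposition[OF assms(1)] by blast
  let ?n = "max_part_size T B"
  have "finite (verts T)" using TD by (auto simp: tree_decomposition_def is_tree_def simple_graph_def)
  then have "card (B t) \<le> ?n" if "t \<in> verts T" for t
    using that by (simp add: max_part_size_def)
  from geodesic_cycle_length_le[OF assms(1,2) TD this] assms(3) have le: "k \<le> (?n - 1) * ?l" by blast
  have cyc: "is_cycle G c" using assms(2) by (simp add: geodesic_cycle_def)
  then have "0 < k" using assms(3) by (auto simp: is_cycle_def)
  \<comment> \<open>Subtraction on natural numbers agrees with real subtraction only for \<open>?n \<ge> 1\<close>.\<close>
  then have "1 \<le> ?n" using le by (cases ?n) auto
  have "0 < ?l" using cycle_space_gen_ge_3[OF assms(1) cyc] by simp
  have "real k \<le> real ((?n - 1) * ?l)" using le by (simp only: of_nat_le_iff)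
  also have "\<dots> = (real ?n - 1) * real ?l" using \<open>1 \<le> ?n\<close> by simp
  also have "real ?n - 1 = real_of_int (tree_width G)" using tw by simp
  finally show ?thesis using \<open>0 < ?l\<close> by (simp add: pos_divide_le_eq)
qed

end
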